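(* Let $\alpha$ be an infinite word over the alphabet $\{0,1\}$ indexed by $\mathbb{N}$. Then $\alpha$ is uniformly recurrent if and only if the age of the structure $C_\alpha$ is ind-minimal.
   Context: For $\alpha=\alpha_0\alpha_1\cdots$, $C_\alpha:=(\mathbb{N},c,u_\alpha)$ where $c=\{(i,i+1):i\in\mathbb{N}\}$ is the consecutivity relation and $u_\alpha=\{i:\alpha_i=1\}$ is a unary relation, viewed as the binary relation $\{(i,i):\alpha_i=1\}$; thus $C_\alpha$ is a binary structure of type 2. A word $\alpha$ is uniformly recurrent if for every finite factor (contiguous finite subword) $u$ of $\alpha$ there is $r$ such that every factor of $\alpha$ of length $r$ contains $u$ as a factor. For binary structures $(E,\rho_1,\dots,\rho_k)$: $A\subseteq E$ is an interval if for all $i$, $a,a'\in A$, $x\notin A$: $x\rho_i a\Leftrightarrow x\rho_i a'$ and $a\rho_i x\Leftrightarrow a'\rho_i x$; indecomposable means only trivial intervals ($\emptyset$, singletons, $E$). $\Omega_k$ is the class of finite binary structures of type $k$ up to isomorphism, $\mathrm{Ind}(\Omega_k)$ its indecomposable members. The age of a structure is the class of its finite restrictions up to isomorphism. A class $\mathcal{C}\subseteq\Omega_k$ is ind-minimal if $\mathcal{C}\cap\mathrm{Ind}(\Omega_k)$ is infinite and for every proper hereditary (closed under embedding) subclass $\mathcal{C}'$ of $\mathcal{C}$, $\mathcal{C}'\cap\mathrm{Ind}(\Omega_k)$ is finite. *)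

theory Defs
  imports Main "HOL-Library.Sublist"
begin

section \<open>Infinite words\<close>

definition factor :: "'a list \<Rightarrow> (nat \<Rightarrow> 'a) \<Rightarrow> bool" where
  "factor u \<alpha> \<longleftrightarrow> (\<exists>i. u = map \<alpha> [i..<i + length u])"

definition uniformly_recurrent :: "(nat \<Rightarrow> 'a) \<Rightarrow> bool" where
  "uniformly_recurrent \<alpha> \<longleftrightarrow>
     (\<forall>u. factor u \<alpha> \<longrightarrow> (\<exists>r. \<forall>v. factor v \<alpha> \<and> length v = r \<longrightarrow> sublist u v))"

section \<open>Binary structures\<close>

datatype 'a bstruct = BStruct (base: "'a set") (rels: "('a \<times> 'a) set list")

definition bstruct :: "nat \<Rightarrow> 'a bstruct \<Rightarrow> bool" where
  "bstruct k S \<longleftrightarrow> length (rels S) = k \<and> (\<forall>\<rho> \<in> set (rels S). \<rho> \<subseteq> base S \<times> base S)"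

definition restriction :: "'a bstruct \<Rightarrow> 'a set \<Rightarrow> 'a bstruct" where
  "restriction S F = BStruct (base S \<inter> F) (map (\<lambda>\<rho>. \<rho> \<inter> F \<times> F) (rels S))"

definition embedding :: "('a \<Rightarrow> 'b) \<Rightarrow> 'a bstruct \<Rightarrow> 'b bstruct \<Rightarrow> bool" where
  "embedding f S T \<longleftrightarrow>
     length (rels S) = length (rels T) \<and>
     inj_on f (base S) \<and> f ` base S \<subseteq> base T \<and>
     (\<forall>i < length (rels S). \<forall>x \<in> base S. \<forall>y \<in> base S.
        (x, y) \<in> rels S ! i \<longleftrightarrow> (f x, f y) \<in> rels T ! i)"

definition embeds :: "'a bstruct \<Rightarrow> 'b bstruct \<Rightarrow> bool" where
  "embeds S T \<longleftrightarrow> (\<exists>f. embedding f S T)"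

definition isomorphic :: "'a bstruct \<Rightarrow> 'b bstruct \<Rightarrow> bool" where
  "isomorphic S T \<longleftrightarrow> (\<exists>f. embedding f S T \<and> f ` base S = base T)"

definition interval :: "'a bstruct \<Rightarrow> 'a set \<Rightarrow> bool" where
  "interval S A \<longleftrightarrow> A \<subseteq> base S \<and>
     (\<forall>\<rho> \<in> set (rels S). \<forall>a \<in> A. \<forall>a' \<in> A. \<forall>x \<in> base S - A.
        ((x, a) \<in> \<rho> \<longleftrightarrow> (x, a') \<in> \<rho>) \<and> ((a, x) \<in> \<rho> \<longleftrightarrow> (a', x) \<in> \<rho>))"

definition indecomposable :: "'a bstruct \<Rightarrow> bool" where
  "indecomposable S \<longleftrightarrow>
     (\<forall>A. interval S A \<longrightarrow> A = {} \<or> (\<exists>a. A = {a}) \<or> A = base S)"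

section \<open>Classes of finite structures up to isomorphism\<close>

text \<open>
  Every finite structure has an isomorphic copy on a set of natural numbers, so the isomorphism
  type of a finite structure (over any type) is represented by the set of all its copies on
  sets of natural numbers. Classes of finite structures are sets of such types; in particular
  finiteness of a class counts structures up to isomorphism. Indecomposability and embeddability
  are invariant under isomorphism, so the choice of representatives below is immaterial.
\<close>

definition iso_type :: "'a bstruct \<Rightarrow> nat bstruct set" where
  "iso_type S = {T. bstruct (length (rels S)) T \<and> isomorphic S T}"

definition Omega :: "nat \<Rightarrow> nat bstruct set set" where
  "Omega k = iso_type ` {S :: nat bstruct. bstruct k S \<and> finite (base S)}"

definition Ind :: "nat bstruct set set \<Rightarrow> nat bstruct set set" where
  "Ind \<C> = {X \<in> \<C>. \<forall>S \<in> X. indecomposable S}"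

definition type_embeds :: "nat bstruct set \<Rightarrow> nat bstruct set \<Rightarrow> bool" where
  "type_embeds X Y \<longleftrightarrow> (\<exists>S \<in> X. \<exists>T \<in> Y. embeds S T)"

definition age :: "'a bstruct \<Rightarrow> nat bstruct set set" where
  "age S = {iso_type (restriction S F) | F. F \<subseteq> base S \<and> finite F}"

definition hereditary :: "nat \<Rightarrow> nat bstruct set set \<Rightarrow> bool" where
  "hereditary k \<C> \<longleftrightarrow> \<C> \<subseteq> Omega k \<and>
     (\<forall>Y \<in> \<C>. \<forall>X \<in> Omega k. type_embeds X Y \<longrightarrow> X \<in> \<C>)"

definition ind_minimal :: "nat \<Rightarrow> nat bstruct set set \<Rightarrow> bool" where
  "ind_minimal k \<C> \<longleftrightarrow> \<C> \<subseteq> Omega k \<and>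
     infinite (\<C> \<inter> Ind (Omega k)) \<and>
     (\<forall>\<C>'. \<C>' \<subset> \<C> \<and> hereditary k \<C>' \<longrightarrow> finite (\<C>' \<inter> Ind (Omega k)))"

section \<open>The structure of a word\<close>

text \<open>The unary relation marking the letter 1 is encoded as a diagonal binary relation.\<close>

definition word_structure :: "(nat \<Rightarrow> nat) \<Rightarrow> nat bstruct" where
  "word_structure \<alpha> = BStruct UNIV [{(i, i + 1) | i. True}, {(i, i) | i. \<alpha> i = 1}]"

end

theory Submission
  imports Defs
begin

text \<open>
  Loops are invisible to intervals, so indecomposability of a restriction of \<open>C\<^sub>\<alpha>\<close> depends only on
  the consecutivity relation, and apart from structures with at most two elements the indecomposable
  restrictions are those to blocks of consecutive integers. These correspond to the finite factors
  of \<open>\<alpha>\<close>, and one block embeds into another exactly when its word is a factor of the other one.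
  If \<open>\<alpha>\<close> is uniformly recurrent, a hereditary class containing long blocks contains every
  factor and hence the whole age. Otherwise some factor \<open>u\<close> is avoided by arbitrarily long
  factors, and the members of the age that do not embed \<open>u\<close> form a proper hereditary
  subclass with infinitely many indecomposables.
\<close>

section \<open>Embeddings and isomorphism types\<close>

lemma embedding_comp:
  assumes "embedding f S T" "embedding g T U"
  shows "embedding (g \<circ> f) S U"
proof -
  have "inj_on (g \<circ> f) (base S)"
    using assms unfolding embedding_def by (meson comp_inj_on inj_on_subset)
  then show ?thesis
    using assms unfolding embedding_def by (auto simp: image_subset_iff)
qed

lemma embeds_trans: "embeds S T \<Longrightarrow> embeds T U \<Longrightarrow> embeds S U"
  unfolding embeds_def using embedding_comp by blast

lemma embeds_refl: "embeds S S"
  unfolding embeds_def embedding_def by (rule exI[of _ id]) auto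

lemma isomorphic_refl: "isomorphic S S"
  unfolding isomorphic_def embedding_def by (rule exI[of _ id]) auto

lemma isomorphic_trans: "isomorphic S T \<Longrightarrow> isomorphic T U \<Longrightarrow> isomorphic S U"
  unfolding isomorphic_def using embedding_comp by (metis image_comp)

lemma isomorphic_sym:
  assumes "isomorphic S T"
  shows "isomorphic T S"
proof -
  obtain f where f: "embedding f S T" "f ` base S = base T"
    using assms unfolding isomorphic_def by blast
  let ?g = "inv_into (base S) f"
  have inj: "inj_on f (base S)"
    using f unfolding embedding_def by blast
  have bij: "bij_betw ?g (base T) (base S)"
    by (intro bij_betw_inv_into bij_betw_imageI inj f(2))
  have inv: "f (?g y) = y" if "y \<in> base T" for y
    using that f(2) by (metis f_inv_into_f)
  have mem: "?g y \<in> base S" if "y \<in> base T" for y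
    using that bij by (auto simp: bij_betw_def)
  have "embedding ?g T S"
    using f(1) bij inv mem unfolding embedding_def by (auto simp: bij_betw_def)
  then show ?thesis
    using bij unfolding isomorphic_def bij_betw_def by blast
qed

lemma isomorphic_embeds: "isomorphic S T \<Longrightarrow> embeds S T"
  unfolding isomorphic_def embeds_def by blast

lemma isomorphic_length_rels: "isomorphic S T \<Longrightarrow> length (rels S) = length (rels T)"
  unfolding isomorphic_def embedding_def by blast

lemma isomorphic_card: "isomorphic S T \<Longrightarrow> card (base S) = card (base T)"
  unfolding isomorphic_def embedding_def by (metis card_image)

lemma mem_iso_type: "bstruct k (S :: nat bstruct) \<Longrightarrow> S \<in> iso_type S"
  unfolding iso_type_def bstruct_def by (auto intro: isomorphic_refl)

lemma iso_type_eqI: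
  assumes "isomorphic S T"
  shows "iso_type S = iso_type T"
proof -
  have "isomorphic S U \<longleftrightarrow> isomorphic T U" for U :: "nat bstruct"
    using isomorphic_trans[OF assms] isomorphic_trans[OF isomorphic_sym[OF assms]]
    by (rule iffI[rotated])
  then show ?thesis
    by (simp add: iso_type_def isomorphic_length_rels[OF assms])
qed

text \<open>A well-formed \<open>T\<close> on naturals belongs to its own type, so equality of types
  puts it into the type of \<open>S\<close>.\<close>

lemma iso_type_eq_iff:
  fixes T :: "nat bstruct"
  assumes "bstruct k T"
  shows "iso_type S = iso_type T \<longleftrightarrow> isomorphic S T"
proof
  assume "iso_type S = iso_type T"
  then show "isomorphic S T"
    using mem_iso_type[OF assms] by (metis (lifting) iso_type_def mem_Collect_eq)
qed (rule iso_type_eqI)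

text \<open>An embedding between any two representatives can be composed with the isomorphisms to
  \<open>S\<close> and \<open>T\<close>, so the choice of representatives is irrelevant.\<close>

lemma type_embeds_iso_type_iff:
  fixes S T :: "nat bstruct"
  assumes "bstruct k S" "bstruct l T"
  shows "type_embeds (iso_type S) (iso_type T) \<longleftrightarrow> embeds S T"
proof
  assume "type_embeds (iso_type S) (iso_type T)"
  then obtain S' T' :: "nat bstruct" where "isomorphic S S'" "isomorphic T T'" "embeds S' T'"
    unfolding type_embeds_def iso_type_def by auto
  then show "embeds S T"
    by (meson embeds_trans isomorphic_embeds isomorphic_sym)
next
  assume "embeds S T"
  then show "type_embeds (iso_type S) (iso_type T)"
    unfolding type_embeds_def using mem_iso_type assms by blast
qed

section \<open>Indecomposability as an isomorphism invariant\<close>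

text \<open>The preimage of an interval under an isomorphism is an interval, and being empty, a
  singleton or the whole base passes back along the image.\<close>

lemma isomorphic_indecomposable:
  assumes "isomorphic S T" "indecomposable S"
  shows "indecomposable T"
  unfolding indecomposable_def
proof (intro allI impI)
  fix A assume A: "interval T A"
  obtain f where f: "embedding f S T" "f ` base S = base T"
    using assms(1) unfolding isomorphic_def by blast
  define B where "B = {x \<in> base S. f x \<in> A}"
  have fB: "f ` B = A"
  proof -
    have "A \<subseteq> f ` base S" using A f(2) by (simp add: interval_def)
    then show ?thesis unfolding B_def by blast
  qed
  have "interval S B"
    unfolding interval_def
  proof (intro conjI ballI)
    show "B \<subseteq> base S" unfolding B_def by blast
  next
    fix \<rho> a a' x
    assume \<rho>: "\<rho> \<in> set (rels S)" and x: "x \<in> base S - B" and a: "a \<in> B" "a' \<in> B"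
    obtain i where i: "i < length (rels S)" "\<rho> = rels S ! i"
      using \<rho> by (metis in_set_conv_nth)
    have iT: "rels T ! i \<in> set (rels T)"
      using i f(1) unfolding embedding_def by simp
    have tr: "(y, z) \<in> \<rho> \<longleftrightarrow> (f y, f z) \<in> rels T ! i" if "y \<in> base S" "z \<in> base S" for y z
      using that i f(1) unfolding embedding_def by blast
    have mem: "a \<in> base S" "a' \<in> base S" "x \<in> base S"
      and imA: "f a \<in> A" "f a' \<in> A" and fx: "f x \<in> base T - A"
      using x a f(2) unfolding B_def by auto
    have "((f x, f a) \<in> rels T ! i \<longleftrightarrow> (f x, f a') \<in> rels T ! i) \<and>
        ((f a, f x) \<in> rels T ! i \<longleftrightarrow> (f a', f x) \<in> rels T ! i)"
      using A iT imA fx unfolding interval_def by blast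
    then show "(x, a) \<in> \<rho> \<longleftrightarrow> (x, a') \<in> \<rho>" "(a, x) \<in> \<rho> \<longleftrightarrow> (a', x) \<in> \<rho>"
      using tr mem by simp_all
  qed
  then have "B = {} \<or> (\<exists>a. B = {a}) \<or> B = base S"
    using assms(2) unfolding indecomposable_def by blast
  then show "A = {} \<or> (\<exists>a. A = {a}) \<or> A = base T"
    unfolding f(2)[symmetric] fB[symmetric] by blast
qed

text \<open>\<open>Ind\<close> quantifies over all representatives of a type; by isomorphism
  invariance a single one decides.\<close>

lemma iso_type_in_Ind_iff:
  fixes S :: "nat bstruct"
  assumes "bstruct k S" "iso_type S \<in> \<C>"
  shows "iso_type S \<in> Ind \<C> \<longleftrightarrow> indecomposable S"
proof -
  have "indecomposable T" if "indecomposable S" "T \<in> iso_type S" for T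
    using that isomorphic_indecomposable[of S T] by (simp add: iso_type_def)
  then show ?thesis
    using assms(2) mem_iso_type[OF assms(1)] unfolding Ind_def by blast
qed

text \<open>Each such structure can be transported to an initial segment of the naturals below
  \<open>n\<close>, where only finitely many bases and lists of \<open>k\<close> relations
  exist.\<close>

lemma finite_types_bounded_card:
  "finite (iso_type ` {S :: nat bstruct. bstruct k S \<and> finite (base S) \<and> card (base S) \<le> n})"
    (is "finite (iso_type ` ?A)")
proof -
  let ?R = "{l. set l \<subseteq> Pow ({..<n} \<times> {..<n}) \<and> length l = k}"
  let ?B = "(\<lambda>(E, l). BStruct E l) ` (Pow {..<n} \<times> ?R)"
  have "finite ?B"
    by (intro finite_imageI finite_cartesian_product finite_lists_length_eq) auto
  moreover have "iso_type S \<in> iso_type ` ?B" if S: "S \<in> ?A" for S :: "nat bstruct"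
  proof -
    let ?E = "{..<card (base S)}"
    obtain f where f: "bij_betw f (base S) ?E"
      using S ex_bij_betw_finite_nat by (auto simp: atLeast0LessThan)
    let ?T = "BStruct ?E (map (\<lambda>\<rho>. map_prod f f ` \<rho>) (rels S))"
    have inj: "inj_on f (base S)" and im: "f ` base S = ?E"
      using f by (auto simp: bij_betw_def)
    have sub: "\<rho> \<subseteq> base S \<times> base S" if "\<rho> \<in> set (rels S)" for \<rho>
      using S that by (auto simp: bstruct_def)
    have rel: "(x, y) \<in> \<rho> \<longleftrightarrow> (f x, f y) \<in> map_prod f f ` \<rho>"
      if \<rho>: "\<rho> \<in> set (rels S)" and xy: "x \<in> base S" "y \<in> base S" for \<rho> x y
    proof
      \<comment> \<open>A pair of \<open>\<rho>\<close> with the same image lies in the base, where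
        \<open>f\<close> is injective, so it is \<open>(x, y)\<close> itself.\<close>
      assume "(f x, f y) \<in> map_prod f f ` \<rho>"
      then obtain x' y' where "(x', y') \<in> \<rho>" "f x = f x'" "f y = f y'" by auto
      then show "(x, y) \<in> \<rho>"
        using sub[OF \<rho>] xy inj by (auto dest: inj_onD)
    qed force
    have "embedding f S ?T"
      using inj im rel by (simp add: embedding_def)
    then have "isomorphic S ?T"
      using im unfolding isomorphic_def by auto
    then have iso: "iso_type S = iso_type ?T" by (rule iso_type_eqI)
    have "?E \<subseteq> {..<n}" using S by auto
    have "map_prod f f ` \<rho> \<subseteq> {..<n} \<times> {..<n}" if "\<rho> \<in> set (rels S)" for \<rho>
    proof -
      have "map_prod f f ` \<rho> \<subseteq> map_prod f f ` (base S \<times> base S)"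
        by (rule image_mono[OF sub[OF that]])
      also have "\<dots> = ?E \<times> ?E"
        by (rule map_prod_surj_on[OF im im])
      also have "\<dots> \<subseteq> {..<n} \<times> {..<n}"
        by (rule Sigma_mono) (use \<open>?E \<subseteq> {..<n}\<close> in simp_all)
      finally show ?thesis .
    qed
    then have "set (map (\<lambda>\<rho>. map_prod f f ` \<rho>) (rels S)) \<subseteq> Pow ({..<n} \<times> {..<n})"
      unfolding set_map by blast
    moreover have "length (map (\<lambda>\<rho>. map_prod f f ` \<rho>) (rels S)) = k"
      using S by (simp add: bstruct_def)
    ultimately have "(?E, map (\<lambda>\<rho>. map_prod f f ` \<rho>) (rels S)) \<in> Pow {..<n} \<times> ?R"
      using \<open>?E \<subseteq> {..<n}\<close> by blast
    from imageI[OF this, of "\<lambda>(E, l). BStruct E l"] have "?T \<in> ?B"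
      by (simp only: prod.case)
    with iso show ?thesis by simp
  qed
  ultimately show ?thesis
    by (intro finite_subset[OF image_subsetI finite_imageI])
qed

section \<open>Restrictions, ages and hereditary subclasses\<close>

lemma base_restriction [simp]: "base (restriction S F) = base S \<inter> F"
  by (simp add: restriction_def)

lemma bstruct_restriction: "bstruct k S \<Longrightarrow> bstruct k (restriction S F)"
  by (auto simp: bstruct_def restriction_def)

lemma embeds_restriction_self: "embeds (restriction S F) S"
  unfolding embeds_def
  by (intro exI[of _ "\<lambda>x. x"]) (auto simp: embedding_def restriction_def)

lemma isomorphic_restriction_image:
  assumes "embedding f S T"
  shows "isomorphic S (restriction T (f ` base S))"
proof -
  have "embedding f S (restriction T (f ` base S))"
    using assms by (auto simp: embedding_def restriction_def)
  moreover have "f ` base S = base (restriction T (f ` base S))"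
    using assms by (auto simp: embedding_def)
  ultimately show ?thesis unfolding isomorphic_def by blast
qed

lemma age_subset_Omega:
  fixes S :: "nat bstruct"
  assumes "bstruct k S"
  shows "age S \<subseteq> Omega k"
  unfolding age_def Omega_def using bstruct_restriction[OF assms] by fastforce

text \<open>The range of an embedding of \<open>S\<close> is the finite subset of \<open>T\<close>
  that witnesses membership in the age.\<close>

lemma iso_type_in_age_iff:
  fixes S T :: "nat bstruct"
  assumes "bstruct k S" "bstruct k T" "finite (base S)"
  shows "iso_type S \<in> age T \<longleftrightarrow> embeds S T"
proof
  assume "iso_type S \<in> age T"
  then obtain F where "iso_type S = iso_type (restriction T F)"
    unfolding age_def by blast
  then have "isomorphic S (restriction T F)"
    using iso_type_eq_iff bstruct_restriction assms(2) by blast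
  then show "embeds S T"
    using embeds_trans isomorphic_embeds embeds_restriction_self by blast
next
  assume "embeds S T"
  then obtain f where f: "embedding f S T" unfolding embeds_def by blast
  then have "iso_type S = iso_type (restriction T (f ` base S))"
    by (intro iso_type_eqI isomorphic_restriction_image)
  moreover have "f ` base S \<subseteq> base T" using f by (simp add: embedding_def)
  ultimately show "iso_type S \<in> age T"
    unfolding age_def mem_Collect_eq
    by (intro exI[of _ "f ` base S"] conjI finite_imageI assms(3))
qed

text \<open>Both conditions descend by transitivity of embedding. With \<open>U\<close> in the age,
  this is the source of proper hereditary subclasses.\<close>

lemma hereditary_age_avoiding:
  fixes S U :: "nat bstruct"
  assumes S: "bstruct k S" and U: "bstruct k U"
  shows "hereditary k {X \<in> age S. \<not> type_embeds (iso_type U) X}"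
  unfolding hereditary_def
proof (intro conjI ballI impI)
  show "{X \<in> age S. \<not> type_embeds (iso_type U) X} \<subseteq> Omega k"
    using age_subset_Omega[OF S] by blast
next
  fix Y X
  assume Y: "Y \<in> {X \<in> age S. \<not> type_embeds (iso_type U) X}"
    and X: "X \<in> Omega k" and XY: "type_embeds X Y"
  obtain F where F: "Y = iso_type (restriction S F)"
    using Y unfolding age_def by blast
  obtain V :: "nat bstruct" where V: "X = iso_type V" "bstruct k V" "finite (base V)"
    using X unfolding Omega_def by blast
  have SF: "bstruct k (restriction S F)" by (rule bstruct_restriction[OF S])
  have VF: "embeds V (restriction S F)"
    using XY type_embeds_iso_type_iff[OF V(2) SF] by (simp add: V(1) F)
  then have "embeds V S"
    using embeds_restriction_self by (rule embeds_trans)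
  then have "X \<in> age S"
    using iso_type_in_age_iff[OF V(2) S V(3)] by (simp add: V(1))
  moreover have "\<not> embeds U (restriction S F)"
    using Y type_embeds_iso_type_iff[OF U SF] by (simp add: F)
  then have "\<not> embeds U V"
    using embeds_trans[OF _ VF] by blast
  then have "\<not> type_embeds (iso_type U) X"
    using type_embeds_iso_type_iff[OF U V(2)] by (simp add: V(1))
  ultimately show "X \<in> {X \<in> age S. \<not> type_embeds (iso_type U) X}" by blast
qed

section \<open>Restrictions of the structure of a word\<close>

lemma bstruct_word_structure: "bstruct 2 (word_structure \<alpha>)"
  by (simp add: bstruct_def word_structure_def)

lemma base_word_structure [simp]: "base (word_structure \<alpha>) = UNIV"
  by (simp add: word_structure_def)

text \<open>The label relation contains only diagonal pairs, and injectivity makes \<open>f\<close>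
  respect the diagonal, so that relation reduces to a condition on single points.\<close>

lemma embedding_word_restriction_iff:
  "embedding f (restriction (word_structure \<alpha>) F) (restriction (word_structure \<alpha>) G) \<longleftrightarrow>
     inj_on f F \<and> f ` F \<subseteq> G \<and>
     (\<forall>x\<in>F. \<forall>y\<in>F. y = Suc x \<longleftrightarrow> f y = Suc (f x)) \<and> (\<forall>x\<in>F. \<alpha> x = 1 \<longleftrightarrow> \<alpha> (f x) = 1)"
proof -
  have "(\<forall>i < Suc (Suc 0). P i) \<longleftrightarrow> P 0 \<and> P (Suc 0)" for P :: "nat \<Rightarrow> bool"
    by (auto simp: less_Suc_eq)
  then show ?thesis
    by (auto simp: embedding_def restriction_def word_structure_def inj_on_eq_iff image_subset_iff)
      metis
qed

text \<open>A point outside \<open>A\<close> never equals a point of \<open>A\<close>, so the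
  diagonal label relation imposes no condition and only consecutivity remains.\<close>

lemma interval_word_restriction_iff:
  "interval (restriction (word_structure \<alpha>) F) A \<longleftrightarrow> A \<subseteq> F \<and>
     (\<forall>a\<in>A. \<forall>a'\<in>A. \<forall>x\<in>F - A. (a = Suc x \<longleftrightarrow> a' = Suc x) \<and> (x = Suc a \<longleftrightarrow> x = Suc a'))"
proof (cases "A \<subseteq> F")
  case True
  have neq: "(x = a) = False" "(a = x) = False" if "a \<in> A" "x \<in> F - A" for a x
    using that by auto
  have xF: "x \<in> F" if "x \<in> F - A" for x
    using that by auto
  show ?thesis
    unfolding interval_def restriction_def word_structure_def
    by (simp add: True True[THEN subsetD] neq xF del: Diff_iff cong: ball_cong)
qed (simp add: interval_def)

section \<open>Indecomposable restrictions and blocks\<close>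

lemma indecomposable_word_block:
  "indecomposable (restriction (word_structure \<alpha>) {i..<j})"
  unfolding indecomposable_def
proof (intro allI impI)
  fix A assume A: "interval (restriction (word_structure \<alpha>) {i..<j}) A"
  then have sub: "A \<subseteq> {i..<j}" by (simp add: interval_word_restriction_iff)
  \<comment> \<open>An outside neighbour of one point of an interval is a neighbour of all its
    points on the same side, but a number has only one successor and at most one
    predecessor.\<close>
  have single: "A = {a}" if "a \<in> A" "x \<in> {i..<j}" "x \<notin> A" "a = Suc x \<or> x = Suc a" for a x
  proof -
    have "a' = a" if "a' \<in> A" for a'
      using A \<open>a \<in> A\<close> \<open>x \<in> {i..<j}\<close> \<open>x \<notin> A\<close> \<open>a = Suc x \<or> x = Suc a\<close> that
      unfolding interval_word_restriction_iff by (metis DiffI nat.inject)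
    then show ?thesis using \<open>a \<in> A\<close> by blast
  qed
  show "A = {} \<or> (\<exists>a. A = {a}) \<or> A = base (restriction (word_structure \<alpha>) {i..<j})"
  proof (rule ccontr)
    assume "\<not> ?thesis"
    then have ne: "A \<noteq> {}" "\<And>a. A \<noteq> {a}" "A \<noteq> {i..<j}" by auto
    \<comment> \<open>Hence a nontrivial interval absorbs neighbours within the block; walking up
      and down from one of its points fills the block.\<close>
    have step: "x \<in> A" if "a \<in> A" "x \<in> {i..<j}" "a = Suc x \<or> x = Suc a" for a x
      using single[OF that(1,2) _ that(3)] ne(2) by blast
    obtain a where a: "a \<in> A" using ne(1) by blast
    then have aij: "i \<le> a" "a < j" using sub by auto
    have up: "a + n < j \<Longrightarrow> a + n \<in> A" for n
    proof (induction n)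
      case (Suc n)
      then show ?case
        using step[of "a + n" "Suc (a + n)"] aij(1) by simp
    qed (use a in simp)
    have down: "n \<le> a \<Longrightarrow> i \<le> a - n \<Longrightarrow> a - n \<in> A" for n
    proof (induction n)
      case (Suc n)
      then have "a - n = Suc (a - Suc n)" by simp
      then show ?case
        using step[of "a - n" "a - Suc n"] aij(2) Suc by simp
    qed (use a in simp)
    have "x \<in> A" if "x \<in> {i..<j}" for x
      using that up[of "x - a"] down[of "a - x"] by (cases "a \<le> x") auto
    then show False using sub ne(3) by blast
  qed
qed

text \<open>The initial run of consecutive elements of \<open>F\<close> is an interval, so it must
  be all of \<open>F\<close>. The bound 2 excludes pairs of non-consecutive numbers, which are
  indecomposable because every two-element structure is.\<close>

lemma indecomposable_word_restrictionD:
  assumes ind: "indecomposable (restriction (word_structure \<alpha>) F)" and F: "2 < card F"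
  shows "\<exists>i. F = {i..<i + card F}"
proof -
  \<comment> \<open>Infinite sets have \<open>card\<close> equal to 0.\<close>
  have fin: "finite F" using F card.infinite by fastforce
  have ind': "A = {} \<or> (\<exists>a. A = {a}) \<or> A = F"
    if "interval (restriction (word_structure \<alpha>) F) A" for A
    using ind that by (auto simp: indecomposable_def)
  define i where "i = Min F"
  have iF: "i \<in> F" and le: "\<And>x. x \<in> F \<Longrightarrow> i \<le> x"
    using fin F Min_in[of F] unfolding i_def by fastforce+
  define A where "A = {x \<in> F. {i..x} \<subseteq> F}"
  have closed: "Suc x \<in> A \<longleftrightarrow> Suc x \<in> F" if "x \<in> A" for x
    using that unfolding A_def by (auto simp: le_Suc_eq subset_iff)
  have closed': "x \<in> A" if "Suc x \<in> A" "x \<in> F" for x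
    using that unfolding A_def by auto
  \<comment> \<open>No element of \<open>F\<close> outside the run \<open>A\<close> is consecutive
    to an element of \<open>A\<close>, on either side.\<close>
  have "interval (restriction (word_structure \<alpha>) F) A"
    unfolding interval_word_restriction_iff using closed closed' unfolding A_def by blast
  moreover have iA: "i \<in> A" using iF unfolding A_def by auto
  \<comment> \<open>Were the run only \<open>{i}\<close>, the minimum would be isolated in
    \<open>F\<close>, and its complement would be a proper interval with at least two
    elements.\<close>
  moreover have "A \<noteq> {i}"
  proof
    assume Ai: "A = {i}"
    then have "Suc i \<notin> F" using closed[of i] by auto
    then have "interval (restriction (word_structure \<alpha>) F) (F - {i})"
      using le unfolding interval_word_restriction_iff by fastforce
    moreover have "1 < card (F - {i})" using F iF by simp
    ultimately show False using ind'[of "F - {i}"] iF by fastforce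
  qed
  ultimately have "A = F" using ind'[of A] by blast
  have "F = {i..<Suc (Max F)}"
  proof
    show "F \<subseteq> {i..<Suc (Max F)}" using le fin by (auto simp: less_Suc_eq_le)
    have "Max F \<in> A" using \<open>A = F\<close> fin iF by (metis Max_in empty_iff)
    then show "{i..<Suc (Max F)} \<subseteq> F" unfolding A_def by (auto simp: less_Suc_eq_le)
  qed
  moreover from this have "card F = Suc (Max F) - i" by (metis card_atLeastLessThan)
  ultimately show ?thesis using F by (intro exI[of _ i]) auto
qed

section \<open>Embeddings of blocks and occurrences of factors\<close>

text \<open>The offset \<open>d\<close> is the length of the prefix that precedes the
  occurrence.\<close>

lemma sublist_map_upt_iff:
  "sublist (map f [a..<a + m]) (map g [b..<b + n]) \<longleftrightarrow>
     (\<exists>d. d + m \<le> n \<and> (\<forall>k<m. f (a + k) = g (b + d + k)))"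
proof
  assume "sublist (map f [a..<a + m]) (map g [b..<b + n])"
  then obtain ps ss where eq: "map g [b..<b + n] = ps @ map f [a..<a + m] @ ss"
    unfolding sublist_def by blast
  have len: "length ps + m \<le> n" using arg_cong[OF eq, of length] by simp
  have "f (a + k) = g (b + length ps + k)" if "k < m" for k
    using arg_cong[OF eq, of "\<lambda>l. l ! (length ps + k)"] len that
    by (simp add: nth_append ac_simps)
  then show "\<exists>d. d + m \<le> n \<and> (\<forall>k<m. f (a + k) = g (b + d + k))" using len by blast
next
  assume "\<exists>d. d + m \<le> n \<and> (\<forall>k<m. f (a + k) = g (b + d + k))"
  then obtain d where d: "d + m \<le> n" "\<And>k. k < m \<Longrightarrow> f (a + k) = g (b + d + k)" by blast
  have "map f [a..<a + m] = take m (drop d (map g [b..<b + n]))"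
    using d by (intro nth_equalityI) (auto simp: ac_simps)
  then show "sublist (map f [a..<a + m]) (map g [b..<b + n])"
    by (metis sublist_drop sublist_order.order_trans sublist_take)
qed

text \<open>An embedding preserves successors, so on a block it is a translation. The structure
  records only whether a letter is 1, which determines the letter over a binary alphabet.\<close>

lemma embeds_word_blockD:
  assumes bin: "\<And>i. \<alpha> i \<in> {0, 1}"
    and emb: "embeds (restriction (word_structure \<alpha>) {a..<a + m})
                (restriction (word_structure \<alpha>) {b..<b + n})"
  shows "sublist (map \<alpha> [a..<a + m]) (map \<alpha> [b..<b + n])"
proof (cases m)
  case (Suc m')
  obtain f where "embedding f (restriction (word_structure \<alpha>) {a..<a + m})
                (restriction (word_structure \<alpha>) {b..<b + n})"
    using emb unfolding embeds_def by blast
  then have img: "f ` {a..<a + m} \<subseteq> {b..<b + n}"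
    and cons: "\<forall>x\<in>{a..<a + m}. \<forall>y\<in>{a..<a + m}. y = Suc x \<longleftrightarrow> f y = Suc (f x)"
    and lab: "\<And>x. a \<le> x \<Longrightarrow> x < a + m \<Longrightarrow> \<alpha> x = 1 \<longleftrightarrow> \<alpha> (f x) = 1"
    unfolding embedding_word_restriction_iff by auto
  have shift: "k < m \<Longrightarrow> f (a + k) = f a + k" for k
  proof (induction k)
    case (Suc k)
    then show ?case using cons[rule_format, of "a + k" "a + Suc k"] by simp
  qed simp
  \<comment> \<open>The images of the first and last points show that the offset
    \<open>f a - b\<close> is a true difference and that the occurrence fits into length
    \<open>n\<close>.\<close>
  have "f a \<in> {b..<b + n}" "f (a + m') \<in> {b..<b + n}"
    by (rule img[THEN subsetD, OF imageI]; use Suc in simp)+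
  then have fa: "b \<le> f a" "f a - b + m \<le> n"
    using shift[of m'] Suc by auto
  have "\<alpha> (a + k) = \<alpha> (b + (f a - b) + k)" if "k < m" for k
  proof -
    have "\<alpha> (a + k) = 1 \<longleftrightarrow> \<alpha> (f a + k) = 1"
      using lab[of "a + k"] shift[OF that] that by simp
    then have "\<alpha> (a + k) = \<alpha> (f a + k)"
      using bin[of "a + k"] bin[of "f a + k"] by auto
    then show ?thesis using fa by simp
  qed
  then show ?thesis
    using fa unfolding sublist_map_upt_iff by blast
qed simp

lemma iso_type_word_block_in_age:
  "iso_type (restriction (word_structure \<alpha>) {i..<j}) \<in> age (word_structure \<alpha>)"
  unfolding age_def by fastforce

text \<open>Blocks are indecomposable, and blocks of different lengths have different types because
  isomorphism preserves cardinality; the starting points \<open>p r\<close> may vary freely.\<close>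

lemma infinite_Ind_if_long_blocks:
  assumes "\<And>r. iso_type (restriction (word_structure \<alpha>) {p r..<p r + r}) \<in> \<C>"
  shows "infinite (\<C> \<inter> Ind (Omega 2))"
proof -
  let ?R = "\<lambda>r. restriction (word_structure \<alpha>) {p r..<p r + r}"
  have bs: "bstruct 2 (?R r)" for r
    by (intro bstruct_restriction bstruct_word_structure)
  have "iso_type (?R r) \<in> Omega 2" for r
    using iso_type_word_block_in_age age_subset_Omega[OF bstruct_word_structure] by blast
  then have "iso_type (?R r) \<in> \<C> \<inter> Ind (Omega 2)" for r
    using iso_type_in_Ind_iff[OF bs] assms indecomposable_word_block by blast
  then have "range (\<lambda>r. iso_type (?R r)) \<subseteq> \<C> \<inter> Ind (Omega 2)" by blast
  moreover have "inj (\<lambda>r. iso_type (?R r))"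
  proof (rule injI)
    fix r s assume "iso_type (?R r) = iso_type (?R s)"
    then have "isomorphic (?R r) (?R s)" using iso_type_eq_iff[OF bs] by blast
    then show "r = s" using isomorphic_card by fastforce
  qed
  ultimately show ?thesis
    using finite_imageD[of "\<lambda>r. iso_type (?R r)" UNIV] finite_subset infinite_UNIV_nat by blast
qed

section \<open>Uniform recurrence and proper hereditary subclasses of the age\<close>

theorem theorem5p23:
  fixes \<alpha> :: "nat \<Rightarrow> nat"
  assumes "\<And>i. \<alpha> i \<in> {0, 1}"
  shows "uniformly_recurrent \<alpha> \<longleftrightarrow> ind_minimal 2 (age (word_structure \<alpha>))"
proof
  let ?W = "word_structure \<alpha>"
  let ?R = "restriction (word_structure \<alpha>)"
  have bs: "bstruct 2 (?R F)" for F
    by (intro bstruct_restriction bstruct_word_structure)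
  show "ind_minimal 2 (age ?W)" if rec: "uniformly_recurrent \<alpha>"
    unfolding ind_minimal_def
  proof (intro conjI allI impI)
    show "age ?W \<subseteq> Omega 2"
      by (rule age_subset_Omega[OF bstruct_word_structure])
    show "infinite (age ?W \<inter> Ind (Omega 2))"
      using infinite_Ind_if_long_blocks iso_type_word_block_in_age by blast
    fix \<C> assume \<C>: "\<C> \<subset> age ?W \<and> hereditary 2 \<C>"
    then obtain F where F: "finite F" "iso_type (?R F) \<in> age ?W" "iso_type (?R F) \<notin> \<C>"
      unfolding age_def by blast
    \<comment> \<open>The missing type lives on a prefix of length \<open>m\<close>; recurrence of
      that prefix as a factor supplies \<open>r\<close>.\<close>
    obtain m where m: "F \<subseteq> {..<m}"
      using F(1) by (auto simp: finite_nat_set_iff_bounded)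
    have "factor (map \<alpha> [0..<0 + m]) \<alpha>"
      unfolding factor_def by (intro exI[of _ 0]) simp
    then obtain r where r: "\<And>v. factor v \<alpha> \<Longrightarrow> length v = r \<Longrightarrow> sublist (map \<alpha> [0..<0 + m]) v"
      using rec unfolding uniformly_recurrent_def by blast
    \<comment> \<open>The bound combines 2, up to which an indecomposable need not be a block, with
      \<open>r\<close>, beyond which a block must contain the prefix.\<close>
    have "\<C> \<inter> Ind (Omega 2) \<subseteq>
        iso_type ` {S :: nat bstruct. bstruct 2 S \<and> finite (base S) \<and> card (base S) \<le> max 2 r}"
      (is "_ \<subseteq> ?B")
    proof
      fix Y assume Y: "Y \<in> \<C> \<inter> Ind (Omega 2)"
      then obtain G where G: "finite G" "Y = iso_type (?R G)"
        using \<C> unfolding age_def by blast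
      have ind: "indecomposable (?R G)"
        using Y G(2) mem_iso_type[OF bs] unfolding Ind_def by blast
      have "card G \<le> max 2 r"
      proof (rule ccontr)
        assume large: "\<not> card G \<le> max 2 r"
        then have "2 < card G" by simp
        then obtain i where i: "G = {i..<i + card G}"
          using indecomposable_word_restrictionD[OF ind] by blast
        have "sublist (map \<alpha> [0..<0 + m]) (map \<alpha> [i..<i + r])"
          by (rule r) (auto simp: factor_def)
        then obtain d where d: "d + m \<le> r" "\<And>k. k < m \<Longrightarrow> \<alpha> k = \<alpha> (i + d + k)"
          unfolding sublist_map_upt_iff by auto
        \<comment> \<open>Translation to the occurrence of the prefix inside \<open>G\<close> embeds
          the missing structure, so heredity would put its type into \<open>\<C>\<close>.\<close>
        have "(\<lambda>k. i + d + k) ` F \<subseteq> G"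
          using m d(1) large by (subst i) fastforce
        moreover have "\<alpha> (i + d + k) = \<alpha> k" if "k \<in> F" for k
          using d(2) m that by force
        ultimately have "embedding (\<lambda>k. i + d + k) (?R F) (?R G)"
          by (simp add: embedding_word_restriction_iff)
        then have "type_embeds (iso_type (?R F)) Y"
          using G(2) type_embeds_iso_type_iff[OF bs bs] unfolding embeds_def by blast
        moreover have "iso_type (?R F) \<in> Omega 2"
          using F(2) age_subset_Omega[OF bstruct_word_structure] by blast
        ultimately show False
          using \<C> Y F(3) unfolding hereditary_def by blast
      qed
      then show "Y \<in> ?B"
        using G bs by auto
    qed
    then show "finite (\<C> \<inter> Ind (Omega 2))"
      by (rule finite_subset[OF _ finite_types_bounded_card])
  qed
  show "uniformly_recurrent \<alpha>" if min: "ind_minimal 2 (age ?W)"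
  proof (rule ccontr)
    assume "\<not> uniformly_recurrent \<alpha>"
    then obtain u where u: "factor u \<alpha>"
      and avoid: "\<And>r. \<exists>v. factor v \<alpha> \<and> length v = r \<and> \<not> sublist u v"
      unfolding uniformly_recurrent_def by blast
    obtain a m where am: "u = map \<alpha> [a..<a + m]"
      using u unfolding factor_def by blast
    have "\<exists>p. \<not> sublist u (map \<alpha> [p..<p + r])" for r
      using avoid[of r] unfolding factor_def by metis
    then obtain p where p: "\<And>r. \<not> sublist u (map \<alpha> [p r..<p r + r])" by metis
    \<comment> \<open>\<open>?U\<close> is a block spelling \<open>u\<close>. It embeds into itself,
      so avoiding it removes at least its own type from the age.\<close>
    let ?U = "?R {a..<a + m}"
    let ?C = "{X \<in> age ?W. \<not> type_embeds (iso_type ?U) X}"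
    have "iso_type ?U \<notin> ?C"
      by (simp add: type_embeds_iso_type_iff[OF bs bs] embeds_refl)
    then have "?C \<subset> age ?W"
      using iso_type_word_block_in_age by blast
    then have "finite (?C \<inter> Ind (Omega 2))"
      using min hereditary_age_avoiding[OF bstruct_word_structure bs]
      unfolding ind_minimal_def by blast
    \<comment> \<open>An embedding of \<open>?U\<close> into this block would exhibit
      \<open>u\<close> as a factor of a word chosen to avoid it.\<close>
    moreover have "iso_type (?R {p r..<p r + r}) \<in> ?C" for r
    proof -
      have "\<not> embeds ?U (?R {p r..<p r + r})"
        using embeds_word_blockD[of \<alpha>, OF assms] p[of r] unfolding am by blast
      then show ?thesis
        by (simp add: iso_type_word_block_in_age type_embeds_iso_type_iff[OF bs bs])
    qed
    then have "infinite (?C \<inter> Ind (Omega 2))"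
      by (rule infinite_Ind_if_long_blocks)
    ultimately show False by blast
  qed
qed

end
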